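(* Let $p\ge2$ and let $(\mathbf u_h^m,\mathbf B_h^m)_{m=0}^N$ be the solution of the fully discrete scheme described in the context. Then there exists a constant $C$, depending on the discrete sources $\mathbf g^m,\mathbf f^m$ (through the bound on $\Delta t\sum_{m}(\|\mathbf g^m\|_{L^2}^2+\frac1{\mu\rho}\|\mathbf f^m\|_{L^2}^2)$ given in the context), on $\|\mathbf u_h^0\|_{L^2}^2$, $\|\mathbf B_h^0\|_{L^2}^2$, $T$ and the physical parameters, but independent of $h$ and $\Delta t$, such that $$\max_{0\le m\le N}\big[\|\mathbf u_h^m\|_{L^2}^2+\|\mathbf B_h^m\|_{L^2}^2\big]\le C,$$ $$\Delta t\sum_{m=1}^N\Big(\frac{\nu}{\rho}\|\nabla\mathbf u_h^m\|_{L^p}^p+\frac1{\mu^2\rho\sigma}\|\nabla\times\mathbf B_h^m\|_{L^2}^2\Big)\le C,$$ $$\sum_{m=1}^N\Big(\|\mathbf u_h^m-\mathbf u_h^{m-1}\|_{L^2}^2+\frac1{\mu\rho}\|\mathbf B_h^m-\mathbf B_h^{m-1}\|_{L^2}^2\Big)\le C.$$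
   Context: $\mathbb D\subset\mathbb R^3$ is a bounded Lipschitz polyhedral domain, $T>0$, and $\nu,\rho,\mu,\sigma>0$ are constants. $(\cdot,\cdot)$ is the $L^2(\mathbb D)$ inner product for scalar, vector and matrix fields. $\mathcal X=W^{1,p}_0(\mathbb D)^3$, $Q=L^2_0(\mathbb D)$ (zero-mean $L^2$ functions), $\mathcal Y=\mathbf H(\mathbf{curl};\mathbb D)$. $\mathcal T_h$ is a regular quasi-uniform tetrahedral triangulation of $\mathbb D$ with mesh size $h$; $k\ge1$; $P_k(K)$ are polynomials of degree at most $k$ on $K$ and $\tilde P_k(K)$ homogeneous polynomials of degree $k$ (scalar- or vector-valued according to context). $\mathcal X_h\subset\{\mathbf v_h\in\mathcal X:\mathbf v_h|_K\in P_k(K)\ \forall K\in\mathcal T_h\}$ and $Q_h\subset\{q_h\in Q: q_h|_K\in P_k(K)\ \forall K\}$ are a pair of finite element spaces satisfying the Babuška–Brezzi (discrete inf-sup) condition. $\mathcal X_{0h}=\{\mathbf v_h\in\mathcal X_h:(\operatorname{div}\mathbf v_h,q_h)=0\ \forall q_h\in Q_h\}$. $\mathcal Y_h=\{\mathbf A_h\in\mathcal Y:\mathbf A_h|_K\in\mathcal N_k(K)\ \forall K\}$ with $\mathcal N_k(K)=P_{k-1}(K)\oplus\{\mathbf q\in\tilde P_k(K):\mathbf q(\mathbf x)\cdot\mathbf x=0\}$ (Nédélec edge elements). $$a_1(\mathbf u,\mathbf w,\mathbf v)=\tfrac12\Big\{\int_{\mathbb D}((\mathbf u\cdot\nabla)\mathbf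 w)\cdot\mathbf v\,dx-\int_{\mathbb D}((\mathbf u\cdot\nabla)\mathbf v)\cdot\mathbf w\,dx\Big\}.$$ Scheme: $\Delta t=T/N$; given $(\mathbf u_h^0,\mathbf B_h^0)\in\mathcal X_{0h}\times\mathcal Y_h$, for $m=1,\dots,N$ the pair $(\mathbf u_h^m,\mathbf B_h^m)\in\mathcal X_{0h}\times\mathcal Y_h$ satisfies, for all $(\mathbf v_h,\mathbf w_h)\in\mathcal X_{0h}\times\mathcal Y_h$, $$\Big(\tfrac{\mathbf u_h^m-\mathbf u_h^{m-1}}{\Delta t},\mathbf v_h\Big)+a_1(\mathbf u_h^{m-1},\mathbf u_h^m,\mathbf v_h)+\frac{\nu}{\rho}\big(|\nabla\mathbf u_h^m|^{p-2}\nabla\mathbf u_h^m,\nabla\mathbf v_h\big)+\frac1{\mu\rho}\big(\mathbf B_h^{m-1}\times(\nabla\times\mathbf B_h^m),\mathbf v_h\big)=(\mathbf g^m,\mathbf v_h),$$ $$\Big(\tfrac{\mathbf B_h^m-\mathbf B_h^{m-1}}{\Delta t},\mathbf w_h\Big)+\frac1{\mu\sigma}(\nabla\times\mathbf B_h^m,\nabla\times\mathbf w_h)-(\mathbf u_h^m\times\mathbf B_h^{m-1},\nabla\times\mathbf w_h)=(\mathbf f^m,\mathbf w_h).$$ The discrete sources $\mathbf g^m,\mathbf f^m\in L^2(\mathbb D)^3$ (finite element approximations of sources $\mathbf g(t_m),\mathbf f(t_m)$, $t_m=m\Delta t$) satisfy $\Delta t\sum_{m=1}^N(\|\mathbf g^m\|_{L^2}^2+\frac1{\mu\rho}\|\mathbf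 f^m\|_{L^2}^2)\le C(\mathbf f,\mathbf g)$ with $C(\mathbf f,\mathbf g)$ independent of $h,\Delta t$. *)

theory Defs
  imports "HOL-Analysis.Analysis"
begin

section \<open>Domains\<close>

text \<open>Near each boundary point, \<open>D\<close> is the strict epigraph, in some direction \<open>e\<close>, of a
  Lipschitz function \<open>\<phi>\<close> on the plane orthogonal to \<open>e\<close>.\<close>

definition lipschitz_domain :: "(real^3) set \<Rightarrow> bool" where
  "lipschitz_domain D \<longleftrightarrow> open D \<and> connected D \<and> D \<noteq> {} \<and>
     (\<forall>x \<in> frontier D. \<exists>U e L \<phi>. open U \<and> x \<in> U \<and> norm e = 1 \<and>
        L-lipschitz_on {z. z \<bullet> e = 0} \<phi> \<and>
        D \<inter> U = {y \<in> U. \<phi> (y - (y \<bullet> e) *\<^sub>R e) < y \<bullet> e})"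

definition polyhedral :: "(real^3) set \<Rightarrow> bool" where
  "polyhedral D \<longleftrightarrow> (\<exists>F. finite F \<and> (\<forall>S \<in> F. polytope S) \<and> closure D = \<Union>F)"

definition bounded_lipschitz_polyhedral_domain :: "(real^3) set \<Rightarrow> bool" where
  "bounded_lipschitz_polyhedral_domain D \<longleftrightarrow> bounded D \<and> lipschitz_domain D \<and> polyhedral D"


section \<open>Lebesgue spaces\<close>

text \<open>Elements of function spaces are represented by functions on the whole of \<open>\<real>\<^sup>3\<close>; only
  their values on \<open>D\<close>, up to null sets, matter.  On matrices, \<open>norm\<close> and \<open>\<bullet>\<close> are the Frobenius
  norm and inner product.\<close>

definition Lp :: "real \<Rightarrow> (real^3) set \<Rightarrow> (real^3 \<Rightarrow> 'b::euclidean_space) set" where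
  "Lp p D = {f. f \<in> borel_measurable (lebesgue_on D) \<and>
                integrable (lebesgue_on D) (\<lambda>x. norm (f x) powr p)}"

definition Lp_norm :: "real \<Rightarrow> (real^3) set \<Rightarrow> (real^3 \<Rightarrow> 'b::euclidean_space) \<Rightarrow> real" where
  "Lp_norm p D f = (integral\<^sup>L (lebesgue_on D) (\<lambda>x. norm (f x) powr p)) powr (1 / p)"

definition L2_inner ::
    "(real^3) set \<Rightarrow> (real^3 \<Rightarrow> 'b::euclidean_space) \<Rightarrow> (real^3 \<Rightarrow> 'b) \<Rightarrow> real" where
  "L2_inner D f g = integral\<^sup>L (lebesgue_on D) (\<lambda>x. f x \<bullet> g x)"

definition L2_zero_mean :: "(real^3) set \<Rightarrow> (real^3 \<Rightarrow> real) set" where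
  "L2_zero_mean D = {q \<in> Lp 2 D. integral\<^sup>L (lebesgue_on D) q = 0}"

definition locally_integrable :: "(real^3) set \<Rightarrow> (real^3 \<Rightarrow> 'b::euclidean_space) \<Rightarrow> bool" where
  "locally_integrable D f \<longleftrightarrow> (\<forall>K. compact K \<and> K \<subseteq> D \<longrightarrow> integrable (lebesgue_on K) f)"


section \<open>Weak derivatives and Sobolev spaces\<close>

definition partial_deriv :: "3 \<Rightarrow> (real^3 \<Rightarrow> 'b::real_normed_vector) \<Rightarrow> real^3 \<Rightarrow> 'b" where
  "partial_deriv j \<phi> x = frechet_derivative \<phi> (at x) (axis j 1)"

primrec iterated_partial :: "3 list \<Rightarrow> (real^3 \<Rightarrow> 'b::real_normed_vector) \<Rightarrow> real^3 \<Rightarrow> 'b" where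
  "iterated_partial [] \<phi> = \<phi>"
| "iterated_partial (j # js) \<phi> = partial_deriv j (iterated_partial js \<phi>)"

text \<open>Test functions \<open>C\<^sub>c\<^sup>\<infinity>(D)\<close>, extended by zero.\<close>

definition test_function :: "(real^3) set \<Rightarrow> (real^3 \<Rightarrow> 'b::real_normed_vector) \<Rightarrow> bool" where
  "test_function D \<phi> \<longleftrightarrow> (\<forall>js x. iterated_partial js \<phi> differentiable (at x)) \<and>
     (\<exists>K. compact K \<and> K \<subseteq> D \<and> (\<forall>x. x \<notin> K \<longrightarrow> \<phi> x = 0))"

text \<open>Gradients of vector fields are Jacobians: \<open>G $ i $ j = \<partial>\<^sub>j u\<^sub>i\<close>.\<close>

definition is_weak_gradient :: "(real^3) set \<Rightarrow> (real^3 \<Rightarrow> real^3) \<Rightarrow> (real^3 \<Rightarrow> real^3^3) \<Rightarrow> bool" where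
  "is_weak_gradient D u G \<longleftrightarrow> locally_integrable D u \<and> locally_integrable D G \<and>
     (\<forall>\<phi>::real^3 \<Rightarrow> real. test_function D \<phi> \<longrightarrow> (\<forall>i j.
        integral\<^sup>L (lebesgue_on D) (\<lambda>x. u x $ i * partial_deriv j \<phi> x) =
        - integral\<^sup>L (lebesgue_on D) (\<lambda>x. G x $ i $ j * \<phi> x)))"

text \<open>The weak gradient is unique only almost everywhere; \<open>SOME\<close> fixes a representative.\<close>

definition weak_gradient :: "(real^3) set \<Rightarrow> (real^3 \<Rightarrow> real^3) \<Rightarrow> real^3 \<Rightarrow> real^3^3" where
  "weak_gradient D u = (SOME G. is_weak_gradient D u G)"

definition weak_div :: "(real^3) set \<Rightarrow> (real^3 \<Rightarrow> real^3) \<Rightarrow> real^3 \<Rightarrow> real" where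
  "weak_div D u x = trace (weak_gradient D u x)"

definition curl_of_jacobian :: "real^3^3 \<Rightarrow> real^3" where
  "curl_of_jacobian G = vector [G$3$2 - G$2$3, G$1$3 - G$3$1, G$2$1 - G$1$2]"

definition is_weak_curl :: "(real^3) set \<Rightarrow> (real^3 \<Rightarrow> real^3) \<Rightarrow> (real^3 \<Rightarrow> real^3) \<Rightarrow> bool" where
  "is_weak_curl D w c \<longleftrightarrow> locally_integrable D w \<and> locally_integrable D c \<and>
     (\<forall>\<Phi>::real^3 \<Rightarrow> real^3. test_function D \<Phi> \<longrightarrow>
        integral\<^sup>L (lebesgue_on D) (\<lambda>x. w x \<bullet> curl_of_jacobian (jacobian \<Phi> (at x))) =
        integral\<^sup>L (lebesgue_on D) (\<lambda>x. c x \<bullet> \<Phi> x))"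

definition weak_curl :: "(real^3) set \<Rightarrow> (real^3 \<Rightarrow> real^3) \<Rightarrow> real^3 \<Rightarrow> real^3" where
  "weak_curl D w = (SOME c. is_weak_curl D w c)"

text \<open>\<open>W\<^sub>0\<^sup>1\<^sup>,\<^sup>p(D)\<^sup>3\<close> is the closure of the test fields in the \<open>W\<^sup>1\<^sup>,\<^sup>p\<close> norm.\<close>

definition W0_1p :: "real \<Rightarrow> (real^3) set \<Rightarrow> (real^3 \<Rightarrow> real^3) set" where
  "W0_1p p D = {u \<in> Lp p D. \<exists>G \<in> Lp p D. is_weak_gradient D u G \<and>
     (\<exists>\<phi>. (\<forall>n::nat. test_function D (\<phi> n)) \<and>
        (\<lambda>n. Lp_norm p D (\<lambda>x. \<phi> n x - u x)) \<longlonglongrightarrow> 0 \<and>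
        (\<lambda>n. Lp_norm p D (\<lambda>x. jacobian (\<phi> n) (at x) - G x)) \<longlonglongrightarrow> 0)}"

definition H_curl :: "(real^3) set \<Rightarrow> (real^3 \<Rightarrow> real^3) set" where
  "H_curl D = {w \<in> Lp 2 D. \<exists>c \<in> Lp 2 D. is_weak_curl D w c}"


section \<open>Triangulations\<close>

definition tetrahedral_mesh :: "(real^3) set \<Rightarrow> (real^3) set set \<Rightarrow> bool" where
  "tetrahedral_mesh D \<T> \<longleftrightarrow> triangulation \<T> \<and> (\<forall>K \<in> \<T>. 3 simplex K) \<and> \<Union>\<T> = closure D"

definition in_diameter :: "(real^3) set \<Rightarrow> real" where
  "in_diameter K = Sup {2 * r | r. 0 \<le> r \<and> (\<exists>x. cball x r \<subseteq> K)}"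

text \<open>The family \<open>\<T>\<close> is indexed by the set \<open>H\<close> of its mesh sizes.  The constant \<open>\<gamma>\<close> of shape
  regularity and quasi-uniformity is common to the whole family.\<close>

definition regular_quasi_uniform_meshes ::
    "(real^3) set \<Rightarrow> real set \<Rightarrow> (real \<Rightarrow> (real^3) set set) \<Rightarrow> bool" where
  "regular_quasi_uniform_meshes D H \<T> \<longleftrightarrow>
     (\<forall>h \<in> H. 0 < h \<and> tetrahedral_mesh D (\<T> h) \<and> h = Max (diameter ` \<T> h)) \<and>
     (\<exists>\<gamma>>0. \<forall>h \<in> H. \<forall>K \<in> \<T> h. diameter K \<le> \<gamma> * in_diameter K \<and> h \<le> \<gamma> * diameter K)"


section \<open>Finite element spaces\<close>

text \<open>Polynomials on \<open>\<real>\<^sup>3\<close> with scalar or vector coefficients \<open>c \<alpha>\<close>, \<open>\<alpha>\<close> ranging over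
  multi-indices.\<close>

definition polys :: "nat \<Rightarrow> (real^3 \<Rightarrow> 'b::real_vector) set" where
  "polys k = {q. \<exists>c :: (3 \<Rightarrow> nat) \<Rightarrow> 'b. \<forall>x.
     q x = (\<Sum>\<alpha> | (\<Sum>i\<in>UNIV. \<alpha> i) \<le> k. (\<Prod>i\<in>UNIV. x $ i ^ \<alpha> i) *\<^sub>R c \<alpha>)}"

definition homogeneous_polys :: "nat \<Rightarrow> (real^3 \<Rightarrow> 'b::real_vector) set" where
  "homogeneous_polys k = {q. \<exists>c :: (3 \<Rightarrow> nat) \<Rightarrow> 'b. \<forall>x.
     q x = (\<Sum>\<alpha> | (\<Sum>i\<in>UNIV. \<alpha> i) = k. (\<Prod>i\<in>UNIV. x $ i ^ \<alpha> i) *\<^sub>R c \<alpha>)}"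

definition nedelec_polys :: "nat \<Rightarrow> (real^3 \<Rightarrow> real^3) set" where
  "nedelec_polys k = {(\<lambda>x. r x + q x) | r q.
     r \<in> polys (k - 1) \<and> q \<in> homogeneous_polys k \<and> (\<forall>x. q x \<bullet> x = 0)}"

text \<open>\<open>v|\<^sub>K \<in> P\<close> for every cell \<open>K\<close>.  The identity is required almost everywhere only: Nedelec
  fields and discontinuous pressures take several values on the common face of two cells.\<close>

definition piecewise_in ::
    "(real^3) set set \<Rightarrow> (real^3 \<Rightarrow> 'b) set \<Rightarrow> (real^3 \<Rightarrow> 'b) set" where
  "piecewise_in \<T> P = {v. \<forall>K \<in> \<T>. \<exists>q \<in> P. AE x in lebesgue_on K. v x = q x}"

definition linear_space :: "(real^3 \<Rightarrow> 'b::real_vector) set \<Rightarrow> bool" where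
  "linear_space V \<longleftrightarrow> (\<lambda>x. 0) \<in> V \<and> (\<forall>f \<in> V. \<forall>g \<in> V. (\<lambda>x. f x + g x) \<in> V) \<and>
     (\<forall>c. \<forall>f \<in> V. (\<lambda>x. c *\<^sub>R f x) \<in> V)"

definition velocity_space ::
    "real \<Rightarrow> (real^3) set \<Rightarrow> nat \<Rightarrow> (real^3) set set \<Rightarrow> (real^3 \<Rightarrow> real^3) set \<Rightarrow> bool" where
  "velocity_space p D k \<T> X \<longleftrightarrow> linear_space X \<and> X \<subseteq> W0_1p p D \<inter> piecewise_in \<T> (polys k)"

definition pressure_space ::
    "(real^3) set \<Rightarrow> nat \<Rightarrow> (real^3) set set \<Rightarrow> (real^3 \<Rightarrow> real) set \<Rightarrow> bool" where
  "pressure_space D k \<T> Q \<longleftrightarrow> linear_space Q \<and> Q \<subseteq> L2_zero_mean D \<inter> piecewise_in \<T> (polys k)"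

text \<open>The Babuska--Brezzi condition, with a constant \<open>\<beta>\<close> common to the family.  Velocities carry
  the norm \<open>\<parallel>\<nabla>v\<parallel>\<close> of \<open>W\<^sub>0\<^sup>1\<^sup>,\<^sup>p\<close>, pressures the norm of \<open>L\<^sup>p\<^sup>'\<close> with the conjugate exponent
  \<open>p' = p / (p - 1)\<close>, which makes \<open>(div v, q)\<close> bounded; for \<open>p = 2\<close> this is the \<open>L\<^sup>2\<close> norm.\<close>

definition discrete_inf_sup ::
    "real \<Rightarrow> (real^3) set \<Rightarrow> real set \<Rightarrow> (real \<Rightarrow> (real^3 \<Rightarrow> real^3) set) \<Rightarrow>
     (real \<Rightarrow> (real^3 \<Rightarrow> real) set) \<Rightarrow> bool" where
  "discrete_inf_sup p D H X Q \<longleftrightarrow> (\<exists>\<beta>>0. \<forall>h \<in> H.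
     ereal \<beta> \<le> (INF q \<in> {q \<in> Q h. Lp_norm (p / (p - 1)) D q \<noteq> 0}.
                 SUP v \<in> {v \<in> X h. Lp_norm p D (weak_gradient D v) \<noteq> 0}.
                   ereal (L2_inner D (weak_div D v) q /
                     (Lp_norm p D (weak_gradient D v) * Lp_norm (p / (p - 1)) D q))))"

definition div_free_space ::
    "(real^3) set \<Rightarrow> (real^3 \<Rightarrow> real^3) set \<Rightarrow> (real^3 \<Rightarrow> real) set \<Rightarrow> (real^3 \<Rightarrow> real^3) set" where
  "div_free_space D X Q = {v \<in> X. \<forall>q \<in> Q. L2_inner D (weak_div D v) q = 0}"

definition nedelec_space :: "(real^3) set \<Rightarrow> nat \<Rightarrow> (real^3) set set \<Rightarrow> (real^3 \<Rightarrow> real^3) set" where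
  "nedelec_space D k \<T> = H_curl D \<inter> piecewise_in \<T> (nedelec_polys k)"


section \<open>The fully discrete scheme\<close>

text \<open>\<open>((u \<cdot> \<nabla>) w)\<^sub>i = \<Sum>\<^sub>j u\<^sub>j \<partial>\<^sub>j w\<^sub>i\<close> is the Jacobian of \<open>w\<close> applied to \<open>u\<close>.\<close>

definition convection :: "(real^3) set \<Rightarrow> (real^3 \<Rightarrow> real^3) \<Rightarrow> (real^3 \<Rightarrow> real^3) \<Rightarrow> real^3 \<Rightarrow> real^3" where
  "convection D u w x = weak_gradient D w x *v u x"

definition a1 ::
    "(real^3) set \<Rightarrow> (real^3 \<Rightarrow> real^3) \<Rightarrow> (real^3 \<Rightarrow> real^3) \<Rightarrow> (real^3 \<Rightarrow> real^3) \<Rightarrow> real" where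
  "a1 D u w v = 1 / 2 * (integral\<^sup>L (lebesgue_on D) (\<lambda>x. convection D u w x \<bullet> v x)
                       - integral\<^sup>L (lebesgue_on D) (\<lambda>x. convection D u v x \<bullet> w x))"

definition p_laplace_flux :: "real \<Rightarrow> (real^3) set \<Rightarrow> (real^3 \<Rightarrow> real^3) \<Rightarrow> real^3 \<Rightarrow> real^3^3" where
  "p_laplace_flux p D u x = norm (weak_gradient D u x) powr (p - 2) *\<^sub>R weak_gradient D u x"

definition momentum_equation ::
    "real \<Rightarrow> real \<Rightarrow> real \<Rightarrow> real \<Rightarrow> (real^3) set \<Rightarrow> real \<Rightarrow> (real^3 \<Rightarrow> real^3) \<Rightarrow>
     (real^3 \<Rightarrow> real^3) \<Rightarrow> (real^3 \<Rightarrow> real^3) \<Rightarrow> (real^3 \<Rightarrow> real^3) \<Rightarrow> (real^3 \<Rightarrow> real^3) \<Rightarrow>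
     (real^3 \<Rightarrow> real^3) \<Rightarrow> bool" where
  "momentum_equation p \<nu> \<rho> \<mu> D dt g u_old B_old u B v \<longleftrightarrow>
     L2_inner D (\<lambda>x. (u x - u_old x) /\<^sub>R dt) v + a1 D u_old u v
     + \<nu> / \<rho> * L2_inner D (p_laplace_flux p D u) (weak_gradient D v)
     + 1 / (\<mu> * \<rho>) * L2_inner D (\<lambda>x. cross3 (B_old x) (weak_curl D B x)) v
     = L2_inner D g v"

definition induction_equation ::
    "real \<Rightarrow> real \<Rightarrow> (real^3) set \<Rightarrow> real \<Rightarrow> (real^3 \<Rightarrow> real^3) \<Rightarrow> (real^3 \<Rightarrow> real^3) \<Rightarrow>
     (real^3 \<Rightarrow> real^3) \<Rightarrow> (real^3 \<Rightarrow> real^3) \<Rightarrow> (real^3 \<Rightarrow> real^3) \<Rightarrow> bool" where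
  "induction_equation \<mu> \<sigma> D dt f B_old u B w \<longleftrightarrow>
     L2_inner D (\<lambda>x. (B x - B_old x) /\<^sub>R dt) w
     + 1 / (\<mu> * \<sigma>) * L2_inner D (weak_curl D B) (weak_curl D w)
     - L2_inner D (\<lambda>x. cross3 (u x) (B_old x)) (weak_curl D w)
     = L2_inner D f w"

definition solves_scheme ::
    "real \<Rightarrow> real \<Rightarrow> real \<Rightarrow> real \<Rightarrow> real \<Rightarrow> (real^3) set \<Rightarrow>
     (real^3 \<Rightarrow> real^3) set \<Rightarrow> (real^3 \<Rightarrow> real^3) set \<Rightarrow> real \<Rightarrow> nat \<Rightarrow>
     (nat \<Rightarrow> real^3 \<Rightarrow> real^3) \<Rightarrow> (nat \<Rightarrow> real^3 \<Rightarrow> real^3) \<Rightarrow>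
     (nat \<Rightarrow> real^3 \<Rightarrow> real^3) \<Rightarrow> (nat \<Rightarrow> real^3 \<Rightarrow> real^3) \<Rightarrow> bool" where
  "solves_scheme p \<nu> \<rho> \<mu> \<sigma> D X0 Y dt N g f u B \<longleftrightarrow>
     (\<forall>m \<le> N. u m \<in> X0 \<and> B m \<in> Y) \<and>
     (\<forall>m \<in> {1..N}. \<forall>v \<in> X0. \<forall>w \<in> Y.
        momentum_equation p \<nu> \<rho> \<mu> D dt (g m) (u (m - 1)) (B (m - 1)) (u m) (B m) v \<and>
        induction_equation \<mu> \<sigma> D dt (f m) (B (m - 1)) (u m) (B m) w)"

end

theory Submission
  imports Defs
begin

text \<open>Testing the scheme with \<open>v = u\<^sup>m\<close> and \<open>w = B\<^sup>m / (\<mu>\<rho>)\<close> makes the convective term vanish and the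
  two coupling terms cancel.  Hence the energy \<open>E\<^sub>m = \<parallel>u\<^sup>m\<parallel>\<^sup>2 + \<parallel>B\<^sup>m\<parallel>\<^sup>2 / (\<mu>\<rho>)\<close> decreases up to the work of the
  sources, which Young's inequality with weight \<open>2T\<close> bounds by \<open>\<Delta>t (2T G\<^sub>m + E\<^sub>m / (2T))\<close>, where
  \<open>G\<^sub>m = \<parallel>g\<^sup>m\<parallel>\<^sup>2 + \<parallel>f\<^sup>m\<parallel>\<^sup>2 / (\<mu>\<rho>)\<close>.  After summation the terms \<open>E\<^sub>m / (2T)\<close> contribute at most half of the maximal
  energy, which is absorbed.  This replaces Gronwall's inequality and needs no smallness of \<open>\<Delta>t\<close>.\<close>

section \<open>Integrability and the Lebesgue norms\<close>

lemma norm_powr_2: "norm (a::'b::real_inner) powr 2 = a \<bullet> a"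
  by (cases "a = 0") (simp_all add: dot_square_norm)

text \<open>Both sides reduce to the same nonnegative integral, which has the value 0 when the
  integrand is not integrable. The identity therefore also covers \<open>weak_curl D B\<close>, a
  representative picked by \<open>SOME\<close>.\<close>

lemma Lp_norm_2_squared: "(Lp_norm 2 D f)\<^sup>2 = L2_inner D f f"
  by (simp add: Lp_norm_def L2_inner_def norm_powr_2 powr_half_sqrt)

lemma Lp_norm_powr:
  assumes "p > 0"
  shows "Lp_norm p D f powr p = integral\<^sup>L (lebesgue_on D) (\<lambda>x. norm (f x) powr p)"
  using assms by (simp add: Lp_norm_def powr_powr)

lemma Lp_2_iff:
  "f \<in> Lp 2 D \<longleftrightarrow> f \<in> borel_measurable (lebesgue_on D) \<and> integrable (lebesgue_on D) (\<lambda>x. f x \<bullet> f x)"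
  by (simp add: Lp_def norm_powr_2)

text \<open>By Cauchy-Schwarz and the arithmetic-geometric mean inequality, the product is dominated
  by the sum of the two squares.\<close>

lemma integrable_inner:
  fixes f g :: "real^3 \<Rightarrow> 'b::euclidean_space"
  assumes "f \<in> Lp 2 D" and "g \<in> Lp 2 D"
  shows "integrable (lebesgue_on D) (\<lambda>x. f x \<bullet> g x)"
proof (rule Bochner_Integration.integrable_bound)
  show "integrable (lebesgue_on D) (\<lambda>x. f x \<bullet> f x + g x \<bullet> g x)"
    using assms by (simp add: Lp_2_iff)
  show "(\<lambda>x. f x \<bullet> g x) \<in> borel_measurable (lebesgue_on D)"
    using assms by (intro borel_measurable_inner) (simp_all add: Lp_2_iff)
  have "norm (a \<bullet> b) \<le> norm (a \<bullet> a + b \<bullet> b)" for a b :: 'b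
  proof -
    have "\<bar>a \<bullet> b\<bar> \<le> norm a * norm b"
      by (rule Cauchy_Schwarz_ineq2)
    also have "\<dots> \<le> (norm a)\<^sup>2 + (norm b)\<^sup>2"
      using sum_squares_bound[of "norm a" "norm b"] mult_nonneg_nonneg[of "norm a" "norm b", OF norm_ge_zero norm_ge_zero]
      unfolding mult.assoc by linarith
    finally show ?thesis
      by (simp add: power2_norm_eq_inner)
  qed
  then show "AE x in lebesgue_on D. norm (f x \<bullet> g x) \<le> norm (f x \<bullet> f x + g x \<bullet> g x)"
    by simp
qed

text \<open>A bounded open set has finite measure, so \<open>1 + a powr p\<close> is an integrable
  majorant of \<open>a powr 2\<close>. This places the velocities, given in
  \<open>W0_1p p D\<close>, in the space where the energy is measured.\<close>

lemma Lp_subset_Lp_2: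
  fixes f :: "real^3 \<Rightarrow> 'b::euclidean_space"
  assumes "2 \<le> p" and "bounded D" and "open D" and f: "f \<in> Lp p D"
  shows "f \<in> Lp 2 D"
proof -
  have fin: "finite_measure (lebesgue_on D)"
    using assms(2,3) by (intro finite_measure_lebesgue_on lmeasurable_open)
  have "integrable (lebesgue_on D) (\<lambda>x. norm (f x) powr 2)"
  proof (rule Bochner_Integration.integrable_bound)
    show "integrable (lebesgue_on D) (\<lambda>x. 1 + norm (f x) powr p)"
      using f fin by (simp add: Lp_def finite_measure.integrable_const)
    show "(\<lambda>x. norm (f x) powr 2) \<in> borel_measurable (lebesgue_on D)"
      using f unfolding norm_powr_2 by (intro borel_measurable_inner) (simp_all add: Lp_def)
    have "a powr 2 \<le> 1 + a powr p" if "0 \<le> a" for a :: real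
    proof (cases "a \<le> 1")
      case True
      have "a powr 2 \<le> 1"
        using powr_le1[of 2 a] that True by simp
      then show ?thesis
        by (simp add: add_increasing2)
    next
      case False
      then have "a powr 2 \<le> a powr p"
        using \<open>2 \<le> p\<close> by (intro powr_mono) auto
      then show ?thesis
        by simp
    qed
    then show "AE x in lebesgue_on D. norm (norm (f x) powr 2) \<le> norm (1 + norm (f x) powr p)"
      by (simp add: abs_of_nonneg)
  qed
  with f show ?thesis
    by (simp add: Lp_def)
qed

section \<open>The individual terms of the scheme, tested with the solution\<close>

lemma L2_inner_difference_quotient:
  fixes u v :: "real^3 \<Rightarrow> 'b::euclidean_space"
  assumes "u \<in> Lp 2 D" and "v \<in> Lp 2 D" and "dt > 0"
  shows "2 * dt * L2_inner D (\<lambda>x. (u x - v x) /\<^sub>R dt) u =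
    (Lp_norm 2 D u)\<^sup>2 - (Lp_norm 2 D v)\<^sup>2 + (Lp_norm 2 D (\<lambda>x. u x - v x))\<^sup>2"
proof -
  note [simp] = integrable_inner[OF assms(1,1)] integrable_inner[OF assms(1,2)]
    integrable_inner[OF assms(2,2)] integrable_inner[OF assms(2,1)]
  have "L2_inner D (\<lambda>x. (u x - v x) /\<^sub>R dt) u = (L2_inner D u u - L2_inner D v u) / dt"
    by (simp add: L2_inner_def inner_diff_left divide_inverse_commute)
  \<comment> \<open>Polarization: \<open>2 * ((a - b) \<bullet> a)\<close> is the difference of the
    squares of \<open>a\<close> and \<open>b\<close> plus the square of \<open>a - b\<close>. This
    last square is the numerical dissipation of implicit Euler and yields the estimate of the
    increments.\<close>
  moreover have "L2_inner D (\<lambda>x. u x - v x) (\<lambda>x. u x - v x) =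
      L2_inner D u u - 2 * L2_inner D v u + L2_inner D v v"
    by (simp add: L2_inner_def inner_diff_left inner_diff_right inner_commute[of "u _" "v _"])
  ultimately show ?thesis
    using \<open>dt > 0\<close> by (simp add: Lp_norm_2_squared)
qed

lemma L2_inner_Young:
  fixes f g :: "real^3 \<Rightarrow> 'b::euclidean_space"
  assumes "f \<in> Lp 2 D" and "g \<in> Lp 2 D" and "T > 0"
  shows "2 * L2_inner D f g \<le> 2 * T * (Lp_norm 2 D f)\<^sup>2 + (Lp_norm 2 D g)\<^sup>2 / (2 * T)"
proof -
  have "2 * (a \<bullet> b) \<le> 2 * T * (a \<bullet> a) + (b \<bullet> b) / (2 * T)" for a b :: 'b
  proof -
    \<comment> \<open>Young's inequality is the expansion of this square.\<close>
    have "0 \<le> ((2 * T) *\<^sub>R a - b) \<bullet> ((2 * T) *\<^sub>R a - b) / (2 * T)"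
      using \<open>T > 0\<close> by simp
    also have "\<dots> = 2 * T * (a \<bullet> a) - 2 * (a \<bullet> b) + (b \<bullet> b) / (2 * T)"
      using \<open>T > 0\<close>
      by (simp add: inner_diff_left inner_diff_right inner_commute[of b a] field_simps)
    finally show ?thesis
      by simp
  qed
  then have "integral\<^sup>L (lebesgue_on D) (\<lambda>x. 2 * (f x \<bullet> g x)) \<le>
      integral\<^sup>L (lebesgue_on D) (\<lambda>x. 2 * T * (f x \<bullet> f x) + (g x \<bullet> g x) / (2 * T))"
    using assms by (intro integral_mono) (simp_all add: integrable_inner)
  then show ?thesis
    using assms by (simp add: Lp_norm_2_squared L2_inner_def integrable_inner)
qed

text \<open>On the diagonal the skew-symmetrised form subtracts an integral from itself, whatever
  the divergence of \<open>u\<close>.\<close>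

lemma a1_same_zero: "a1 D u w w = 0"
  by (simp add: a1_def)

lemma L2_inner_p_laplace_flux:
  assumes "p \<ge> 2"
  shows "L2_inner D (p_laplace_flux p D u) (weak_gradient D u) = Lp_norm p D (weak_gradient D u) powr p"
proof -
  \<comment> \<open>At \<open>a = 0\<close> both sides vanish, even for \<open>p = 2\<close>,
    because \<open>0 powr 0 = 0\<close>.\<close>
  have "norm a powr (p - 2) * (a \<bullet> a) = norm a powr p" for a :: "real^3^3"
    unfolding norm_powr_2[symmetric] powr_add[symmetric] by simp
  then show ?thesis
    using assms by (simp add: L2_inner_def p_laplace_flux_def Lp_norm_powr)
qed

text \<open>Cyclic invariance of the triple product. It turns the Lorentz force tested with the
  velocity into the coupling term that the induction equation carries with the opposite
  sign.\<close>

lemma L2_inner_cross3_swap: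
  "L2_inner D (\<lambda>x. cross3 (b x) (c x)) u = L2_inner D (\<lambda>x. cross3 (u x) (b x)) c"
proof -
  have "cross3 (b x) (c x) \<bullet> u x = cross3 (u x) (b x) \<bullet> c x" for x
    by (metis cross_triple inner_commute)
  then show ?thesis
    by (simp add: L2_inner_def)
qed

section \<open>Energy balance of one time step, primes marking the previous level\<close>

lemma energy_step:
  assumes "p \<ge> 2" and "dt > 0" and pos: "\<rho> > 0" "\<mu> > 0" "\<sigma> > 0" "T > 0"
    and L2: "g \<in> Lp 2 D" "f \<in> Lp 2 D" "u \<in> Lp 2 D" "u' \<in> Lp 2 D" "B \<in> Lp 2 D" "B' \<in> Lp 2 D"
    and mom: "momentum_equation p \<nu> \<rho> \<mu> D dt g u' B' u B u"
    and ind: "induction_equation \<mu> \<sigma> D dt f B' u B B"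
  shows "((Lp_norm 2 D u)\<^sup>2 + 1 / (\<mu> * \<rho>) * (Lp_norm 2 D B)\<^sup>2)
    - ((Lp_norm 2 D u')\<^sup>2 + 1 / (\<mu> * \<rho>) * (Lp_norm 2 D B')\<^sup>2)
    + (((Lp_norm 2 D (\<lambda>x. u x - u' x))\<^sup>2 + 1 / (\<mu> * \<rho>) * (Lp_norm 2 D (\<lambda>x. B x - B' x))\<^sup>2)
      + 2 * dt * (\<nu> / \<rho> * Lp_norm p D (weak_gradient D u) powr p
              + 1 / (\<mu>\<^sup>2 * \<rho> * \<sigma>) * (Lp_norm 2 D (weak_curl D B))\<^sup>2))
    \<le> dt * (2 * T * ((Lp_norm 2 D g)\<^sup>2 + 1 / (\<mu> * \<rho>) * (Lp_norm 2 D f)\<^sup>2)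
      + ((Lp_norm 2 D u)\<^sup>2 + 1 / (\<mu> * \<rho>) * (Lp_norm 2 D B)\<^sup>2) / (2 * T))"
    (is "?E - ?E' + (?J + 2 * dt * ?V) \<le> dt * (2 * T * ?G + ?E / (2 * T))")
proof -
  \<comment> \<open>Instead of testing with a scaled field, the induction equation is tested with
    \<open>B\<close> and multiplied by \<open>l\<close>. This matches the factor of the Lorentz
    force and turns \<open>1 / (\<mu> * \<sigma>)\<close> into the coefficient of the curl term in
    \<open>?V\<close>.\<close>
  define l where "l = 1 / (\<mu> * \<rho>)"
  have "l > 0"
    using pos by (simp add: l_def)
  define K where "K = L2_inner D (\<lambda>x. cross3 (u x) (B' x)) (weak_curl D B)"
  define tu where "tu = L2_inner D (\<lambda>x. (u x - u' x) /\<^sub>R dt) u"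
  define tB where "tB = L2_inner D (\<lambda>x. (B x - B' x) /\<^sub>R dt) B"
  define G where "G = Lp_norm p D (weak_gradient D u) powr p"
  define R where "R = (Lp_norm 2 D (weak_curl D B))\<^sup>2"
  have mom': "tu + \<nu> / \<rho> * G + l * K = L2_inner D g u"
    using mom \<open>p \<ge> 2\<close>
    by (simp add: momentum_equation_def a1_same_zero L2_inner_p_laplace_flux L2_inner_cross3_swap
        tu_def G_def K_def l_def)
  have ind': "tB + 1 / (\<mu> * \<sigma>) * R - K = L2_inner D f B"
    using ind by (simp add: induction_equation_def tB_def R_def K_def Lp_norm_2_squared)
  have "?E - ?E' + ?J = 2 * dt * tu + l * (2 * dt * tB)"
    unfolding tu_def tB_def l_def[symmetric]
      L2_inner_difference_quotient[OF L2(3,4) \<open>dt > 0\<close>] L2_inner_difference_quotient[OF L2(5,6) \<open>dt > 0\<close>]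
    by (simp add: algebra_simps)
  moreover have "?V = \<nu> / \<rho> * G + l * (1 / (\<mu> * \<sigma>) * R)"
    by (simp add: G_def R_def l_def power2_eq_square)
  \<comment> \<open>The terms \<open>l * K\<close> and \<open>- l * K\<close> cancel, so inserting
    them recovers the left-hand sides of the two tested equations.\<close>
  ultimately have "?E - ?E' + (?J + 2 * dt * ?V) =
      2 * dt * (tu + \<nu> / \<rho> * G + l * K) + l * (2 * dt * (tB + 1 / (\<mu> * \<sigma>) * R - K))"
    by (simp add: algebra_simps)
  also have "\<dots> = dt * (2 * L2_inner D g u + l * (2 * L2_inner D f B))"
    unfolding mom' ind' by (simp add: algebra_simps)
  also have "\<dots> \<le> dt * ((2 * T * (Lp_norm 2 D g)\<^sup>2 + (Lp_norm 2 D u)\<^sup>2 / (2 * T))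
      + l * (2 * T * (Lp_norm 2 D f)\<^sup>2 + (Lp_norm 2 D B)\<^sup>2 / (2 * T)))"
    using L2 pos \<open>dt > 0\<close> \<open>l > 0\<close>
    by (intro mult_left_mono add_mono L2_inner_Young) simp_all
  also have "\<dots> = dt * (2 * T * ?G + ?E / (2 * T))"
    by (simp add: l_def[symmetric] algebra_simps add_divide_distrib)
  finally show ?thesis .
qed

section \<open>Summation in time and the resulting a priori bounds\<close>

lemma discrete_energy_bound:
  fixes E R G :: "nat \<Rightarrow> real"
  assumes "T > 0" and "N \<ge> 1" and dt: "dt = T / real N"
    and E: "\<And>m. 0 \<le> E m" and R: "\<And>m. 0 \<le> R m" and G: "\<And>m. 0 \<le> G m"
    and sources: "dt * (\<Sum>m=1..N. G m) \<le> M"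
    and step: "\<And>m. m \<in> {1..N} \<Longrightarrow> E m - E (m - 1) + R m \<le> dt * (2 * T * G m + E m / (2 * T))"
  shows "\<forall>n\<le>N. E n \<le> 2 * E 0 + 4 * T * M" and "(\<Sum>m=1..N. R m) \<le> 2 * E 0 + 4 * T * M"
proof -
  define X where "X = Max (E ` {0..N})"
  have EX: "E n \<le> X" if "n \<le> N" for n
    using that by (simp add: X_def)
  have "dt > 0"
    using assms by simp
  have telescoped: "E n + (\<Sum>m=1..n. R m) \<le> E 0 + (\<Sum>m=1..n. dt * (2 * T * G m + X / (2 * T)))"
    if "n \<le> N" for n
    using that
  proof (induction n)
    case 0
    show ?case
      by simp
  next
    case (Suc n)
    have "E (Suc n) - E n + R (Suc n) \<le> dt * (2 * T * G (Suc n) + E (Suc n) / (2 * T))"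
      using step[of "Suc n"] Suc.prems by simp
    \<comment> \<open>Bounding the new energy by the maximum \<open>X\<close> spares solving for
      \<open>E (Suc n)\<close>, which would restrict \<open>dt\<close>.\<close>
    also have "\<dots> \<le> dt * (2 * T * G (Suc n) + X / (2 * T))"
      using EX[OF Suc.prems] \<open>dt > 0\<close> \<open>T > 0\<close>
      by (intro mult_left_mono add_left_mono divide_right_mono) auto
    finally show ?case
      using Suc by simp
  qed
  have "0 \<le> X"
    using E[of 0] EX[of 0] by simp
  have bound: "E n + (\<Sum>m=1..n. R m) \<le> E 0 + 2 * T * M + X / 2" if "n \<le> N" for n
  proof -
    \<comment> \<open>All summands are nonnegative, so extending the sum to \<open>N\<close> gives a
      bound uniform in \<open>n\<close>.\<close>
    have "(\<Sum>m=1..n. dt * (2 * T * G m + X / (2 * T))) \<le> (\<Sum>m=1..N. dt * (2 * T * G m + X / (2 * T)))"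
      using that \<open>dt > 0\<close> \<open>T > 0\<close> \<open>0 \<le> X\<close> G by (intro sum_mono2) auto
    also have "\<dots> = 2 * T * (dt * (\<Sum>m=1..N. G m)) + real N * dt * (X / (2 * T))"
      by (simp add: sum.distrib distrib_left sum_distrib_left algebra_simps)
    \<comment> \<open>Since \<open>N * dt = T\<close>, the weight \<open>2 * T\<close> leaves
      exactly half of the maximum.\<close>
    also have "real N * dt * (X / (2 * T)) = X / 2"
      using \<open>T > 0\<close> \<open>N \<ge> 1\<close> by (simp add: dt)
    also have "2 * T * (dt * (\<Sum>m=1..N. G m)) + X / 2 \<le> 2 * T * M + X / 2"
      using sources \<open>T > 0\<close> by simp
    finally show ?thesis
      using telescoped[OF that] by simp
  qed
  \<comment> \<open>At an index attaining the maximum, \<open>bound\<close> reads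
    \<open>X \<le> E 0 + 2 * T * M + X / 2\<close>. Absorbing \<open>X / 2\<close> doubles the
    data.\<close>
  have "X \<in> E ` {0..N}"
    unfolding X_def by (intro Max_in) auto
  then obtain n where "n \<le> N" and "X = E n"
    by auto
  moreover have "0 \<le> (\<Sum>m=1..n. R m)"
    by (simp add: R sum_nonneg)
  ultimately have X: "X \<le> 2 * E 0 + 4 * T * M"
    using bound[of n] by simp
  show "\<forall>n\<le>N. E n \<le> 2 * E 0 + 4 * T * M"
    using EX X by force
  show "(\<Sum>m=1..N. R m) \<le> 2 * E 0 + 4 * T * M"
    using bound[of N] E[of N] X by simp
qed

text \<open>The bound cannot see the mesh: \<open>X0\<close> and \<open>Y\<close> act only as sets
  of test functions inside \<open>Lp 2 D\<close>, and the solution itself is admissible in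
  them.\<close>

lemma scheme_energy_bounds:
  fixes p \<nu> \<rho> \<mu> \<sigma> T M :: real
  assumes "p \<ge> 2" and pos: "\<nu> > 0" "\<rho> > 0" "\<mu> > 0" "\<sigma> > 0" "T > 0"
    and X0: "X0 \<subseteq> Lp 2 D" and Y: "Y \<subseteq> Lp 2 D"
    and "N \<ge> 1" and dt: "dt = T / real N"
    and L2: "\<forall>m\<in>{1..N}. g m \<in> Lp 2 D \<and> f m \<in> Lp 2 D"
    and sources: "dt * (\<Sum>m=1..N. (Lp_norm 2 D (g m))\<^sup>2 + 1 / (\<mu> * \<rho>) * (Lp_norm 2 D (f m))\<^sup>2) \<le> M"
    and scheme: "solves_scheme p \<nu> \<rho> \<mu> \<sigma> D X0 Y dt N g f u B"
    and K: "2 * ((Lp_norm 2 D (u 0))\<^sup>2 + 1 / (\<mu> * \<rho>) * (Lp_norm 2 D (B 0))\<^sup>2) + 4 * T * M \<le> K"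
  shows "\<forall>m\<le>N. (Lp_norm 2 D (u m))\<^sup>2 + 1 / (\<mu> * \<rho>) * (Lp_norm 2 D (B m))\<^sup>2 \<le> K"
    and "2 * (dt * (\<Sum>m=1..N. \<nu> / \<rho> * Lp_norm p D (weak_gradient D (u m)) powr p
              + 1 / (\<mu>\<^sup>2 * \<rho> * \<sigma>) * (Lp_norm 2 D (weak_curl D (B m)))\<^sup>2)) \<le> K"
    and "(\<Sum>m=1..N. (Lp_norm 2 D (\<lambda>x. u m x - u (m - 1) x))\<^sup>2
              + 1 / (\<mu> * \<rho>) * (Lp_norm 2 D (\<lambda>x. B m x - B (m - 1) x))\<^sup>2) \<le> K"
proof -
  define E where "E m = (Lp_norm 2 D (u m))\<^sup>2 + 1 / (\<mu> * \<rho>) * (Lp_norm 2 D (B m))\<^sup>2" for m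
  define G where "G m = (Lp_norm 2 D (g m))\<^sup>2 + 1 / (\<mu> * \<rho>) * (Lp_norm 2 D (f m))\<^sup>2" for m
  define J where "J m = (Lp_norm 2 D (\<lambda>x. u m x - u (m - 1) x))\<^sup>2
    + 1 / (\<mu> * \<rho>) * (Lp_norm 2 D (\<lambda>x. B m x - B (m - 1) x))\<^sup>2" for m
  define V where "V m = \<nu> / \<rho> * Lp_norm p D (weak_gradient D (u m)) powr p
    + 1 / (\<mu>\<^sup>2 * \<rho> * \<sigma>) * (Lp_norm 2 D (weak_curl D (B m)))\<^sup>2" for m
  have "dt > 0"
    using pos \<open>N \<ge> 1\<close> by (simp add: dt)
  have nonneg: "0 \<le> E m" "0 \<le> G m" "0 \<le> J m" "0 \<le> V m" for m
    using pos by (auto simp: E_def G_def J_def V_def)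
  have mem: "u m \<in> X0" "B m \<in> Y" if "m \<le> N" for m
    using scheme that by (auto simp: solves_scheme_def)
  have step: "E m - E (m - 1) + (J m + 2 * dt * V m) \<le> dt * (2 * T * G m + E m / (2 * T))"
    if m: "m \<in> {1..N}" for m
    unfolding E_def G_def J_def V_def
  proof (rule energy_step)
    have "m \<le> N" "m - 1 \<le> N"
      using m by auto
    from mem[OF this(1)] mem[OF this(2)] X0 Y
    show "u m \<in> Lp 2 D" "u (m - 1) \<in> Lp 2 D" "B m \<in> Lp 2 D" "B (m - 1) \<in> Lp 2 D"
      by auto
    show "g m \<in> Lp 2 D" "f m \<in> Lp 2 D"
      using L2 m by auto
    show "momentum_equation p \<nu> \<rho> \<mu> D dt (g m) (u (m - 1)) (B (m - 1)) (u m) (B m) (u m)"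
      "induction_equation \<mu> \<sigma> D dt (f m) (B (m - 1)) (u m) (B m) (B m)"
      using scheme m mem[OF \<open>m \<le> N\<close>] by (auto simp: solves_scheme_def)
  qed (use \<open>dt > 0\<close> \<open>p \<ge> 2\<close> pos in simp_all)
  have R: "0 \<le> J m + 2 * dt * V m" for m
    using nonneg[of m] \<open>dt > 0\<close> by simp
  have "dt * (\<Sum>m=1..N. G m) \<le> M"
    using sources by (simp add: G_def)
  note bounds = discrete_energy_bound[where E = E and G = G and R = "\<lambda>m. J m + 2 * dt * V m",
      OF \<open>T > 0\<close> \<open>N \<ge> 1\<close> dt nonneg(1) R nonneg(2) this step]
  have EK: "2 * E 0 + 4 * T * M \<le> K"
    using K by (simp add: E_def)
  show "\<forall>m\<le>N. (Lp_norm 2 D (u m))\<^sup>2 + 1 / (\<mu> * \<rho>) * (Lp_norm 2 D (B m))\<^sup>2 \<le> K"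
    using bounds(1) EK unfolding E_def[symmetric] by force
  have "(\<Sum>m=1..N. J m) + 2 * (dt * (\<Sum>m=1..N. V m)) \<le> K"
    using bounds(2) EK by (simp add: sum.distrib sum_distrib_left mult.assoc)
  \<comment> \<open>Increments and dissipation are bounded jointly; as both sums are nonnegative,
    each inherits the bound.\<close>
  moreover have "0 \<le> (\<Sum>m=1..N. J m)" "0 \<le> dt * (\<Sum>m=1..N. V m)"
    using nonneg \<open>dt > 0\<close> by (simp_all add: sum_nonneg)
  ultimately have "2 * (dt * (\<Sum>m=1..N. V m)) \<le> K" "(\<Sum>m=1..N. J m) \<le> K"
    by linarith+
  then show "2 * (dt * (\<Sum>m=1..N. \<nu> / \<rho> * Lp_norm p D (weak_gradient D (u m)) powr p
              + 1 / (\<mu>\<^sup>2 * \<rho> * \<sigma>) * (Lp_norm 2 D (weak_curl D (B m)))\<^sup>2)) \<le> K"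
    and "(\<Sum>m=1..N. (Lp_norm 2 D (\<lambda>x. u m x - u (m - 1) x))\<^sup>2
              + 1 / (\<mu> * \<rho>) * (Lp_norm 2 D (\<lambda>x. B m x - B (m - 1) x))\<^sup>2) \<le> K"
    by (simp_all add: V_def J_def)
qed

text \<open>Independence of \<open>h\<close> and \<open>dt\<close> is expressed by the order of
  quantifiers: only the physical parameters, \<open>T\<close> and the data bounds \<open>M\<close>,
  \<open>U0\<close>, \<open>B0\<close> are fixed before \<open>C\<close>.\<close>

theorem lemma4p2:
  fixes p \<nu> \<rho> \<mu> \<sigma> T M U0 B0 :: real
  assumes "p \<ge> 2" and "\<nu> > 0" and "\<rho> > 0" and "\<mu> > 0" and "\<sigma> > 0" and "T > 0"
  shows "\<exists>C::real. \<forall>D (k::nat) H \<T> X Q.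
    bounded_lipschitz_polyhedral_domain D \<longrightarrow> k \<ge> 1 \<longrightarrow>
    regular_quasi_uniform_meshes D H \<T> \<longrightarrow>
    (\<forall>h\<in>H. velocity_space p D k (\<T> h) (X h)) \<longrightarrow>
    (\<forall>h\<in>H. pressure_space D k (\<T> h) (Q h)) \<longrightarrow>
    discrete_inf_sup p D H X Q \<longrightarrow>
    (\<forall>h\<in>H. \<forall>(N::nat) dt g f u B.
      N \<ge> 1 \<longrightarrow> dt = T / real N \<longrightarrow>
      (\<forall>m\<in>{1..N}. g m \<in> Lp 2 D \<and> f m \<in> Lp 2 D) \<longrightarrow>
      dt * (\<Sum>m=1..N. (Lp_norm 2 D (g m))\<^sup>2 + 1 / (\<mu> * \<rho>) * (Lp_norm 2 D (f m))\<^sup>2) \<le> M \<longrightarrow>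
      solves_scheme p \<nu> \<rho> \<mu> \<sigma> D (div_free_space D (X h) (Q h)) (nedelec_space D k (\<T> h))
        dt N g f u B \<longrightarrow>
      (Lp_norm 2 D (u 0))\<^sup>2 \<le> U0 \<longrightarrow> (Lp_norm 2 D (B 0))\<^sup>2 \<le> B0 \<longrightarrow>
      Max ((\<lambda>m. (Lp_norm 2 D (u m))\<^sup>2 + (Lp_norm 2 D (B m))\<^sup>2) ` {0..N}) \<le> C \<and>
      dt * (\<Sum>m=1..N. \<nu> / \<rho> * Lp_norm p D (weak_gradient D (u m)) powr p
              + 1 / (\<mu>\<^sup>2 * \<rho> * \<sigma>) * (Lp_norm 2 D (weak_curl D (B m)))\<^sup>2) \<le> C \<and>
      (\<Sum>m=1..N. (Lp_norm 2 D (\<lambda>x. u m x - u (m - 1) x))\<^sup>2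
              + 1 / (\<mu> * \<rho>) * (Lp_norm 2 D (\<lambda>x. B m x - B (m - 1) x))\<^sup>2) \<le> C)"
proof -
  \<comment> \<open>\<open>K\<close> bounds the energy weighted by
    \<open>1 / (\<mu> * \<rho>)\<close>. The factor \<open>1 + \<mu> * \<rho>\<close> in the witness
    removes this weight from the magnetic part, and being at least 1 it also serves the other two
    estimates.\<close>
  define K where "K = 2 * (U0 + 1 / (\<mu> * \<rho>) * B0) + 4 * T * M"
  show ?thesis
  proof (rule exI[of _ "K * (1 + \<mu> * \<rho>)"], intro allI ballI impI)
    fix D :: "(real^3) set" and k H \<T> X Q h N dt g f u B
    assume D: "bounded_lipschitz_polyhedral_domain D"
      and X: "\<forall>h\<in>H. velocity_space p D k (\<T> h) (X h)" and h: "h \<in> H"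
      and N: "N \<ge> 1" "dt = T / real N"
      and L2: "\<forall>m\<in>{1..N}. g m \<in> Lp 2 D \<and> f m \<in> Lp 2 D"
      and sources:
        "dt * (\<Sum>m=1..N. (Lp_norm 2 D (g m))\<^sup>2 + 1 / (\<mu> * \<rho>) * (Lp_norm 2 D (f m))\<^sup>2) \<le> M"
      and scheme: "solves_scheme p \<nu> \<rho> \<mu> \<sigma> D (div_free_space D (X h) (Q h)) (nedelec_space D k (\<T> h))
        dt N g f u B"
      and init: "(Lp_norm 2 D (u 0))\<^sup>2 \<le> U0" "(Lp_norm 2 D (B 0))\<^sup>2 \<le> B0"
    have "bounded D" "open D"
      using D by (auto simp: bounded_lipschitz_polyhedral_domain_def lipschitz_domain_def)
    then have X0: "div_free_space D (X h) (Q h) \<subseteq> Lp 2 D"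
      using X h \<open>p \<ge> 2\<close>
      by (force simp: div_free_space_def velocity_space_def W0_1p_def intro: Lp_subset_Lp_2)
    have Y: "nedelec_space D k (\<T> h) \<subseteq> Lp 2 D"
      by (auto simp: nedelec_space_def H_curl_def)
    have "2 * ((Lp_norm 2 D (u 0))\<^sup>2 + 1 / (\<mu> * \<rho>) * (Lp_norm 2 D (B 0))\<^sup>2) + 4 * T * M \<le> K"
      using init assms unfolding K_def by (intro add_right_mono add_mono mult_left_mono) auto
    note bounds = scheme_energy_bounds[OF assms X0 Y N L2 sources scheme this]
    \<comment> \<open>The sign of \<open>K\<close> comes from the solution: its initial energy is
      nonnegative and at most \<open>K\<close>. It is used to enlarge \<open>K\<close> to the
      witness and to drop the factor 2 before the dissipation sum.\<close>
    have "0 \<le> (Lp_norm 2 D (u 0))\<^sup>2 + 1 / (\<mu> * \<rho>) * (Lp_norm 2 D (B 0))\<^sup>2"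
      using assms by simp
    then have "0 \<le> K"
      using bounds(1) by force
    then have KC: "K \<le> K * (1 + \<mu> * \<rho>)"
      using assms by (simp add: algebra_simps)
    have "(Lp_norm 2 D (u m))\<^sup>2 + (Lp_norm 2 D (B m))\<^sup>2 \<le> K * (1 + \<mu> * \<rho>)" if "m \<le> N" for m
    proof -
      define a where "a = (Lp_norm 2 D (u m))\<^sup>2"
      define b where "b = 1 / (\<mu> * \<rho>) * (Lp_norm 2 D (B m))\<^sup>2"
      have nonneg: "0 \<le> a" "0 \<le> b"
        using assms by (simp_all add: a_def b_def)
      have ab: "a + b \<le> K"
        using bounds(1) that by (simp add: a_def b_def)
      have "\<mu> * \<rho> * b \<le> \<mu> * \<rho> * K"
        using ab nonneg assms by (intro mult_left_mono) auto
      then have "a + \<mu> * \<rho> * b \<le> K * (1 + \<mu> * \<rho>)"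
        using ab nonneg by (simp add: algebra_simps)
      moreover have "\<mu> * \<rho> * b = (Lp_norm 2 D (B m))\<^sup>2"
        using assms by (simp add: b_def)
      ultimately show ?thesis
        by (simp add: a_def)
    qed
    then have "Max ((\<lambda>m. (Lp_norm 2 D (u m))\<^sup>2 + (Lp_norm 2 D (B m))\<^sup>2) ` {0..N}) \<le> K * (1 + \<mu> * \<rho>)"
      by simp
    then show "Max ((\<lambda>m. (Lp_norm 2 D (u m))\<^sup>2 + (Lp_norm 2 D (B m))\<^sup>2) ` {0..N}) \<le> K * (1 + \<mu> * \<rho>) \<and>
      dt * (\<Sum>m=1..N. \<nu> / \<rho> * Lp_norm p D (weak_gradient D (u m)) powr p
              + 1 / (\<mu>\<^sup>2 * \<rho> * \<sigma>) * (Lp_norm 2 D (weak_curl D (B m)))\<^sup>2) \<le> K * (1 + \<mu> * \<rho>) \<and>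
      (\<Sum>m=1..N. (Lp_norm 2 D (\<lambda>x. u m x - u (m - 1) x))\<^sup>2
              + 1 / (\<mu> * \<rho>) * (Lp_norm 2 D (\<lambda>x. B m x - B (m - 1) x))\<^sup>2) \<le> K * (1 + \<mu> * \<rho>)"
      using bounds(2,3) KC \<open>0 \<le> K\<close> by linarith
  qed
qed

end
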